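(* Let $p$ be a prime with $p\equiv5\pmod 8$, $g$ a primitive root modulo $p$, $d=4$, $k=(p-1)/4$, $e_p(x)=e^{2\pi i x/p}$, and $\eta_a=\sum_{j=0}^{k-1}e_p(g^{4j+a})$. Let $V_4(p)=\sum_{s=0}^{3}|\eta_s|^4$. Let $\Gamma=\langle g^4\rangle$ and let $t_2$ be the number of pairs $(a,b)\in\Gamma\times\Gamma$ with $a+b=g^2$ in $\mathbb{F}_p$ (so that $16t_2$ is the number of $\mathbb{F}_p$-rational points in $\mathbb{P}^2(\mathbb{F}_p)$ on the curve $x^4+y^4=g^2z^4$). Then $$V_4(p)=\frac{1}{576}\Big(p^3+71p^2+256pt_2^2-32(p-5)pt_2+79p+9\Big).$$ Moreover, $$\frac{1}{64}(9p^2+6p+1)\le V_4(p)\le\frac{1}{64}(13p^2+8p^{3/2}+10p+1).$$ *)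

theory Defs
  imports "HOL-Analysis.Analysis" "HOL-Number_Theory.Number_Theory"
begin

text \<open>
  Elements of the prime field with \<open>p\<close> elements are represented by their residues in
  \<open>{0..<p}\<close>.
\<close>

definition e_p :: "nat \<Rightarrow> real \<Rightarrow> complex" where
  "e_p p x = exp (2 * of_real pi * \<i> * of_real x / of_nat p)"

text \<open>The Gaussian period of degree \<open>d\<close>; meaningful for \<open>d\<close> dividing \<open>p - 1\<close>.\<close>

definition gauss_period :: "nat \<Rightarrow> nat \<Rightarrow> nat \<Rightarrow> nat \<Rightarrow> complex" where
  "gauss_period p d g a = (\<Sum>j<(p - 1) div d. e_p p (real (g ^ (d * j + a))))"

definition V4 :: "nat \<Rightarrow> nat \<Rightarrow> real" where
  "V4 p g = (\<Sum>s<4. cmod (gauss_period p 4 g s) ^ 4)"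

text \<open>
  The cyclic group generated by \<open>g ^ 4\<close>. The ambient group is finite, so nonnegative exponents
  give the whole subgroup.
\<close>

definition Gam :: "nat \<Rightarrow> nat \<Rightarrow> nat set" where
  "Gam p g = {(g ^ 4) ^ j mod p | j :: nat. True}"

definition t2 :: "nat \<Rightarrow> nat \<Rightarrow> nat" where
  "t2 p g = card {(a, b) \<in> Gam p g \<times> Gam p g. [a + b = g ^ 2] (mod p)}"

definition nonzero_triples :: "nat \<Rightarrow> (nat \<times> nat \<times> nat) set" where
  "nonzero_triples p = {0..<p} \<times> {0..<p} \<times> {0..<p} - {(0, 0, 0)}"

definition proportional :: "nat \<Rightarrow> ((nat \<times> nat \<times> nat) \<times> (nat \<times> nat \<times> nat)) set" where
  "proportional p = {((x, y, z), (x', y', z')).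
     (x, y, z) \<in> nonzero_triples p \<and> (x', y', z') \<in> nonzero_triples p \<and>
     (\<exists>c\<in>{1..<p}. [x' = c * x] (mod p) \<and> [y' = c * y] (mod p) \<and> [z' = c * z] (mod p))}"

definition proj_plane :: "nat \<Rightarrow> (nat \<times> nat \<times> nat) set set" where
  "proj_plane p = nonzero_triples p // proportional p"

definition curve_points :: "nat \<Rightarrow> nat \<Rightarrow> (nat \<times> nat \<times> nat) set set" where
  "curve_points p g =
     {P \<in> proj_plane p. \<forall>(x, y, z)\<in>P. [x ^ 4 + y ^ 4 = g ^ 2 * z ^ 4] (mod p)}"

end

theory Submission
  imports Defs
begin

text \<open>
  Let \<open>p = 4 k + 1\<close> with \<open>k\<close> odd. Then \<open>-1\<close> lies in \<open>g\<^sup>2 \<Gamma>\<close>, so \<open>\<eta>\<^sub>2\<close> and \<open>\<eta>\<^sub>3\<close> are the complex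
  conjugates of \<open>\<eta>\<^sub>0\<close> and \<open>\<eta>\<^sub>1\<close>. Put \<open>a = 2 Re \<eta>\<^sub>0\<close>, \<open>b = 2 Re \<eta>\<^sub>1\<close>, \<open>A = |\<eta>\<^sub>0|\<^sup>2\<close>, \<open>B = |\<eta>\<^sub>1|\<^sup>2\<close>.
  Orthogonality of the additive characters evaluates the sums over \<open>s\<close> of \<open>\<eta>\<^sub>s\<close>, \<open>|\<eta>\<^sub>s|\<^sup>2\<close>,
  \<open>\<eta>\<^sub>s\<^sup>2\<close> and \<open>\<eta>\<^sub>s\<^sup>3\<close>; only the cubic one involves \<open>t\<^sub>2\<close>. These four equations give
  \<open>a + b = -1\<close>, \<open>(a - b)\<^sup>2 = p\<close>, \<open>A + B = (3 p + 1) / 8\<close> and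
  \<open>(A - B) (a - b) = p (p - 5 - 16 t\<^sub>2) / 24\<close>. As \<open>V\<^sub>4 = 2 (A\<^sup>2 + B\<^sup>2) = (A + B)\<^sup>2 + (A - B)\<^sup>2\<close>, this
  yields the formula and the lower bound. The upper bound needs no estimate for the number of
  points on the curve: \<open>a\<^sup>2 \<le> 4 A\<close> and \<open>b\<^sup>2 \<le> 4 B\<close> already force \<open>|A - B| \<le> (p + sqrt p) / 4\<close>.
\<close>

section \<open>Additive characters modulo \<open>p\<close>\<close>

lemma e_p_of_nat: "e_p p (real n) = exp (2 * of_real pi * \<i> * of_nat n / of_nat p)"
  by (simp add: e_p_def)

lemma e_p_add: "e_p p (x + y) = e_p p x * e_p p y"
  by (simp add: e_p_def algebra_simps add_divide_distrib flip: exp_add)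

lemma e_p_cong:
  assumes "0 < p" and "[m = n] (mod p)"
  shows "e_p p (real m) = e_p p (real n)"
  using assms complex_root_unity_eq[of p m n] by (simp add: e_p_of_nat cong_def)

lemma e_p_eq_1_iff:
  assumes "0 < p"
  shows "e_p p (real n) = 1 \<longleftrightarrow> p dvd n"
  using assms complex_root_unity_eq_1[of p n] by (simp add: e_p_of_nat)

lemma e_p_power: "e_p p (real (x * n)) = e_p p (real n) ^ x"
  by (simp add: e_p_def mult_ac flip: exp_of_nat_mult)

lemma norm_e_p [simp]: "cmod (e_p p x) = 1"
proof -
  have "e_p p x = exp (\<i> * of_real (2 * pi * x / real p))"
    by (simp add: e_p_def mult_ac)
  then show ?thesis by (simp only: norm_exp_i_times)
qed

text \<open>Residues are natural numbers, so that \<open>n\<close> represents \<open>-m\<close> is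
  expressed by \<open>p dvd m + n\<close>. The two values are then inverse on the unit circle, hence
  conjugate.\<close>

lemma cnj_e_p:
  assumes "0 < p" and "p dvd m + n"
  shows "cnj (e_p p (real m)) = e_p p (real n)"
proof -
  have "e_p p (real m) * e_p p (real n) = 1"
    using assms e_p_eq_1_iff[of p "m + n"] by (simp add: e_p_add)
  moreover have "e_p p (real m) * cnj (e_p p (real m)) = 1"
    using complex_norm_square[of "e_p p (real m)"] by simp
  ultimately show ?thesis
    by (metis mult_cancel_left mult_zero_left zero_neq_one)
qed

lemma sum_e_p_multiples:
  assumes "0 < p"
  shows "(\<Sum>x<p. e_p p (real (x * n))) = (if p dvd n then of_nat p else 0)"
proof (cases "p dvd n")
  case True
  then have "e_p p (real n) = 1" using assms e_p_eq_1_iff by blast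
  then show ?thesis using True by (simp only: e_p_power) simp
next
  case False
  then have "e_p p (real n) \<noteq> 1" using assms e_p_eq_1_iff by blast
  moreover have "e_p p (real n) ^ p = 1"
    using e_p_eq_1_iff[OF assms, of "p * n"] by (simp only: e_p_power) simp
  ultimately show ?thesis
    using False by (simp only: e_p_power sum_gp_strict) simp
qed

text \<open>Orthogonality as a counting device: after the sums are swapped, each index contributes
  \<open>p\<close> or \<open>0\<close>. Every moment of the periods is evaluated this way.\<close>

lemma sum_e_p_count:
  assumes "0 < p" and "finite S"
  shows "(\<Sum>x<p. \<Sum>i\<in>S. e_p p (real (x * f i))) = of_nat p * of_nat (card {i \<in> S. p dvd f i})"
proof -
  have "(\<Sum>x<p. \<Sum>i\<in>S. e_p p (real (x * f i))) = (\<Sum>i\<in>S. if p dvd f i then of_nat p else 0)"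
    by (subst sum.swap) (simp only: sum_e_p_multiples[OF assms(1)])
  also have "\<dots> = of_nat p * of_nat (card {i \<in> S. p dvd f i})"
    using assms(2) by (simp add: sum.If_cases Int_def)
  finally show ?thesis .
qed

section \<open>Scaling modulo a prime\<close>

text \<open>Both sides are homogeneous of degree 4, so the equation of the curve depends only on the
  projective point.\<close>

lemma fourth_powers_cong_scale:
  fixes m c x y z x' y' z' w :: nat
  assumes "[x ^ 4 + y ^ 4 = w * z ^ 4] (mod m)"
    and "[x' = c * x] (mod m)" "[y' = c * y] (mod m)" "[z' = c * z] (mod m)"
  shows "[x' ^ 4 + y' ^ 4 = w * z' ^ 4] (mod m)"
proof -
  have "[x' ^ 4 + y' ^ 4 = (c * x) ^ 4 + (c * y) ^ 4] (mod m)"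
    by (intro cong_add cong_pow assms)
  also have "(c * x) ^ 4 + (c * y) ^ 4 = c ^ 4 * (x ^ 4 + y ^ 4)"
    by (simp add: power_mult_distrib algebra_simps)
  also have "[\<dots> = c ^ 4 * (w * z ^ 4)] (mod m)"
    by (intro cong_mult cong_refl assms)
  also have "c ^ 4 * (w * z ^ 4) = w * (c * z) ^ 4"
    by (simp add: power_mult_distrib)
  also have "[\<dots> = w * z' ^ 4] (mod m)"
    by (intro cong_mult cong_refl cong_pow cong_sym[OF assms(4)])
  finally show ?thesis .
qed

lemma unit_inverse_mod_prime:
  fixes p c :: nat
  assumes "prime p" and "\<not> p dvd c"
  obtains c' where "c' \<in> {1..<p}" "[c' * c = 1] (mod p)"
proof -
  have "coprime c p" using prime_imp_coprime_nat[OF assms] by (simp add: coprime_commute)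
  then obtain b where b: "[c * b = 1] (mod p)" using cong_solve_coprime_nat by auto
  have "p > 1" using assms(1) by (rule prime_gt_1_nat)
  have inv: "[b mod p * c = 1] (mod p)"
    using b by (simp add: cong_def mod_simps mult.commute)
  then have "b mod p \<noteq> 0" using \<open>p > 1\<close> by (metis cong_def mod_0 mod_less mult_zero_left zero_neq_one)
  then show ?thesis using that[of "b mod p"] inv \<open>p > 1\<close> by simp
qed

text \<open>The nonzero scalars modulo a prime form a group: inverses give symmetry and products,
  reduced into \<open>{1..<p}\<close>, give transitivity.\<close>

lemma equiv_proportional:
  assumes "prime p"
  shows "equiv (nonzero_triples p) (proportional p)"
proof (rule equivI)
  have p: "p > 1" using assms by (rule prime_gt_1_nat)
  show "proportional p \<subseteq> nonzero_triples p \<times> nonzero_triples p"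
    by (auto simp: proportional_def)
  show "refl_on (nonzero_triples p) (proportional p)"
    using p by (force intro!: refl_onI simp: proportional_def)
  show "sym (proportional p)"
  proof (rule symI, clarify)
    fix x y z x' y' z' assume "((x, y, z), (x', y', z')) \<in> proportional p"
    then obtain c where c: "c \<in> {1..<p}"
      and tr: "(x, y, z) \<in> nonzero_triples p" "(x', y', z') \<in> nonzero_triples p"
      and scale: "[x' = c * x] (mod p)" "[y' = c * y] (mod p)" "[z' = c * z] (mod p)"
      by (auto simp: proportional_def)
    have "\<not> p dvd c" using c by (auto dest: dvd_imp_le)
    then obtain c' where c': "c' \<in> {1..<p}" "[c' * c = 1] (mod p)"
      by (rule unit_inverse_mod_prime[OF assms])
    have inverse: "[u = c' * u'] (mod p)" if "[u' = c * u] (mod p)" for u u'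
    proof -
      have "[c' * u' = c' * (c * u)] (mod p)" using that by (rule cong_scalar_left)
      also have "c' * (c * u) = c' * c * u" by simp
      also have "[c' * c * u = 1 * u] (mod p)" using c'(2) by (rule cong_scalar_right)
      finally show ?thesis by (simp add: cong_sym)
    qed
    show "((x', y', z'), (x, y, z)) \<in> proportional p"
      using c'(1) tr scale[THEN inverse] by (auto simp: proportional_def intro!: bexI[of _ c'])
  qed
  show "trans (proportional p)"
  proof (rule transI, clarify)
    fix x y z x' y' z' x'' y'' z''
    assume l: "((x, y, z), (x', y', z')) \<in> proportional p"
      and r: "((x', y', z'), (x'', y'', z'')) \<in> proportional p"
    from l obtain b where bp: "b \<in> {1..<p}"
      and b: "[x' = b * x] (mod p)" "[y' = b * y] (mod p)" "[z' = b * z] (mod p)"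
      by (auto simp: proportional_def)
    from r obtain c where cp: "c \<in> {1..<p}"
      and c: "[x'' = c * x'] (mod p)" "[y'' = c * y'] (mod p)" "[z'' = c * z'] (mod p)"
      by (auto simp: proportional_def)
    have tr: "(x, y, z) \<in> nonzero_triples p" "(x'', y'', z'') \<in> nonzero_triples p"
      using l r by (simp_all add: proportional_def)
    have "\<not> p dvd b" "\<not> p dvd c" using bp cp by (auto dest: dvd_imp_le)
    then have "\<not> p dvd c * b" using assms by (simp add: prime_dvd_mult_iff)
    then have cb: "c * b mod p \<in> {1..<p}"
      using p by (simp add: Suc_le_eq mod_greater_zero_iff_not_dvd)
    have compose: "[u'' = c * b mod p * u] (mod p)"
      if "[u' = b * u] (mod p)" "[u'' = c * u'] (mod p)" for u u' u''
    proof -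
      have "[c * u' = c * (b * u)] (mod p)" using that(1) by (rule cong_scalar_left)
      then have "[u'' = c * (b * u)] (mod p)" using that(2) by (rule cong_trans[rotated])
      then show ?thesis by (simp add: cong_def mod_simps mult.assoc)
    qed
    show "((x, y, z), (x'', y'', z'')) \<in> proportional p"
      using cb tr compose[OF b(1) c(1)] compose[OF b(2) c(2)] compose[OF b(3) c(3)]
      by (auto simp: proportional_def intro!: bexI[of _ "c * b mod p"])
  qed
qed

section \<open>The group of fourth powers\<close>

text \<open>This is the condition that \<open>p\<close> is 5 modulo 8. Oddness of \<open>k\<close>
  makes \<open>2 * k\<close> congruent to 2 modulo 4, which places -1 in the coset of
  \<open>g ^ 2\<close>.\<close>

locale quartic_periods =
  fixes p g k :: nat
  assumes prime_p: "prime p" and p_eq: "p = 4 * k + 1" and odd_k: "odd k"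
    and primroot: "residue_primroot p g"
begin

section \<open>Powers of the primitive root\<close>

lemma p_pos: "0 < p" and p_gt_1: "1 < p" and k_pos: "0 < k"
  using p_eq odd_k by (auto simp: odd_pos)

lemma coprime_g: "coprime p g"
  using primroot by (simp add: residue_primroot_def)

lemma ord_g: "ord p g = 4 * k"
  using primroot prime_p p_eq by (simp add: residue_primroot_def totient_prime)

lemma pow_g_cong_iff: "[g ^ m = g ^ n] (mod p) \<longleftrightarrow> [m = n] (mod 4 * k)"
  using order_divides_expdiff[OF coprime_g] by (simp add: ord_g)

lemma not_dvd_pow_g: "\<not> p dvd g ^ n"
  using coprime_g prime_p by (metis coprime_absorb_left coprime_power_right_iff not_prime_unit)

lemma not_dvd_imp_pow_g:
  assumes "\<not> p dvd x"
  obtains n where "n < 4 * k" "[x = g ^ n] (mod p)"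
proof -
  have bij: "bij_betw (\<lambda>i. g ^ i mod p) {..<4 * k} {0<..<p}"
    using residue_primroot_is_generator[OF p_gt_1 primroot] prime_p p_eq
    by (simp add: totient_prime totatives_prime)
  have "x mod p \<in> {0<..<p}"
    using assms p_pos by (simp add: mod_greater_zero_iff_not_dvd)
  then have "x mod p \<in> (\<lambda>i. g ^ i mod p) ` {..<4 * k}"
    using bij_betw_imp_surj_on[OF bij] by simp
  then obtain n where "x mod p = g ^ n mod p" "n \<in> {..<4 * k}"
    by (rule imageE)
  then show ?thesis using that[of n] by (simp add: cong_def)
qed

text \<open>The square of \<open>g ^ (2 * k)\<close> is 1 modulo \<open>p\<close>, while
  \<open>g ^ (2 * k)\<close> itself is not, because \<open>g\<close> has order
  \<open>4 * k\<close>.\<close>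

lemma neg_one_cong: "[g ^ (2 * k) + 1 = 0] (mod p)"
proof -
  have "[g ^ (4 * k) = g ^ 0] (mod p)"
    by (subst pow_g_cong_iff) (simp add: cong_def)
  then have "[g ^ (2 * k) * g ^ (2 * k) = 1] (mod p)"
    by (simp flip: power_add)
  \<comment> \<open>Subtraction of naturals truncates, so this bound is needed to factor the
    difference of squares.\<close>
  moreover have pos: "1 \<le> g ^ (2 * k)"
    using not_dvd_pow_g[of "2 * k"] by (cases "g ^ (2 * k) = 0") auto
  ultimately have "p dvd g ^ (2 * k) * g ^ (2 * k) - 1"
    by (subst (asm) cong_altdef_nat) auto
  also have "g ^ (2 * k) * g ^ (2 * k) - 1 = (g ^ (2 * k) - 1) * (g ^ (2 * k) + 1)"
    by (simp add: algebra_simps)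
  finally have "p dvd g ^ (2 * k) - 1 \<or> p dvd g ^ (2 * k) + 1"
    using prime_p by (simp only: prime_dvd_mult_iff)
  moreover have "\<not> [g ^ (2 * k) = g ^ 0] (mod p)"
    using k_pos by (subst pow_g_cong_iff) (simp add: cong_def)
  then have "\<not> p dvd g ^ (2 * k) - 1"
    using pos by (simp add: cong_altdef_nat)
  ultimately show ?thesis by (simp only: cong_0_iff) simp
qed

text \<open>\<open>g ^ (2 * k)\<close> stands for -1, which allows negation within the natural
  numbers.\<close>

lemma dvd_sum_iff_cong_neg: "p dvd x + y \<longleftrightarrow> [x = g ^ (2 * k) * y] (mod p)"
proof -
  have "[g ^ (2 * k) * y + y = 0] (mod p)"
    using cong_scalar_right[OF neg_one_cong, of y] by (simp add: algebra_simps)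
  then have "p dvd x + y \<longleftrightarrow> [x + y = g ^ (2 * k) * y + y] (mod p)"
    by (metis cong_0_iff cong_sym cong_trans)
  then show ?thesis by (simp add: cong_add_rcancel_nat)
qed

section \<open>The subgroup of fourth powers and sums of its elements\<close>

abbreviation \<Gamma> :: "nat set" where "\<Gamma> \<equiv> Gam p g"

lemma Gam_iff: "a \<in> \<Gamma> \<longleftrightarrow> (\<exists>j. a = g ^ (4 * j) mod p)"
  by (auto simp: Gam_def power_mult)

lemma Gam_less: "a \<in> \<Gamma> \<Longrightarrow> a < p"
  using p_pos by (auto simp: Gam_iff)

lemma finite_Gam [simp]: "finite \<Gamma>"
  by (rule finite_subset[of _ "{..<p}"]) (auto simp: Gam_less)

lemma pow_in_Gam: "g ^ (4 * j) mod p \<in> \<Gamma>"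
  by (auto simp: Gam_iff)

lemma pow_4_in_Gam:
  assumes "\<not> p dvd x"
  shows "x ^ 4 mod p \<in> \<Gamma>"
proof -
  obtain n where "[x = g ^ n] (mod p)" using not_dvd_imp_pow_g[OF assms] by blast
  then have "[x ^ 4 = g ^ (4 * n)] (mod p)"
    using cong_pow[of x "g ^ n" p 4] by (simp add: mult.commute flip: power_mult)
  then show ?thesis using pow_in_Gam[of n] by (simp add: cong_def)
qed

lemma not_dvd_Gam: "a \<in> \<Gamma> \<Longrightarrow> \<not> p dvd a"
  using not_dvd_pow_g by (auto simp: Gam_iff dvd_mod_iff)

lemma bij_betw_Gam: "bij_betw (\<lambda>j. g ^ (4 * j) mod p) {..<k} \<Gamma>"
proof (rule bij_betw_imageI)
  show "inj_on (\<lambda>j. g ^ (4 * j) mod p) {..<k}"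
  proof (rule inj_onI)
    fix i j assume "i \<in> {..<k}" "j \<in> {..<k}" "g ^ (4 * i) mod p = g ^ (4 * j) mod p"
    then show "i = j"
      using pow_g_cong_iff[of "4 * i" "4 * j"] by (simp add: cong_def)
  qed
  have "g ^ (4 * j) mod p = g ^ (4 * (j mod k)) mod p" for j
    using pow_g_cong_iff[of "4 * j" "4 * (j mod k)"] by (simp add: cong_def)
  then show "(\<lambda>j. g ^ (4 * j) mod p) ` {..<k} = \<Gamma>"
    using k_pos by (auto simp: Gam_iff image_iff) (metis lessThan_iff mod_less_divisor)
qed

lemma card_Gam: "card \<Gamma> = k"
  using bij_betw_same_card[OF bij_betw_Gam] by simp

text \<open>Translation by a group element: injective by cancellation, hence onto by
  finiteness.\<close>

lemma bij_betw_Gam_mult: "bij_betw (\<lambda>a. a * g ^ (4 * i) mod p) \<Gamma> \<Gamma>"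
proof -
  have "(\<lambda>a. a * g ^ (4 * i) mod p) ` \<Gamma> \<subseteq> \<Gamma>"
  proof (rule image_subsetI)
    fix a assume "a \<in> \<Gamma>"
    then obtain j where "a = g ^ (4 * j) mod p" by (auto simp: Gam_iff)
    then have "a * g ^ (4 * i) mod p = g ^ (4 * (j + i)) mod p"
      by (simp add: mod_mult_left_eq power_add distrib_left)
    then show "a * g ^ (4 * i) mod p \<in> \<Gamma>"
      by (simp only: pow_in_Gam)
  qed
  moreover have "inj_on (\<lambda>a. a * g ^ (4 * i) mod p) \<Gamma>"
  proof (rule inj_onI)
    fix a b assume "a \<in> \<Gamma>" "b \<in> \<Gamma>" "a * g ^ (4 * i) mod p = b * g ^ (4 * i) mod p"
    then show "a = b"
      using cong_mult_rcancel_nat[of "g ^ (4 * i)" p a b] coprime_g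
      by (simp add: cong_def Gam_less coprime_commute)
  qed
  ultimately show ?thesis
    by (simp add: bij_betw_def endo_inj_surj)
qed

lemma no_Gam_sum_zero:
  assumes "a \<in> \<Gamma>" "b \<in> \<Gamma>"
  shows "\<not> p dvd a + b"
proof
  assume "p dvd a + b"
  moreover obtain i j where ij: "a = g ^ (4 * i) mod p" "b = g ^ (4 * j) mod p"
    using assms by (auto simp: Gam_iff)
  ultimately have "[g ^ (4 * i) = g ^ (2 * k + 4 * j)] (mod p)"
    by (simp add: dvd_sum_iff_cong_neg cong_def power_add mod_simps)
  then have "[4 * i = 2 * k + 4 * j] (mod 4 * k)" by (simp add: pow_g_cong_iff)
  \<comment> \<open>Modulo 4 this says that 4 divides \<open>2 * k\<close>, which is false for odd
    \<open>k\<close>.\<close>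
  then have "[4 * i = 2 * k + 4 * j] (mod 4)" by (rule cong_dvd_modulus_nat) simp
  then show False using odd_k by (simp add: cong_def) presburger
qed

text \<open>Since -1 lies in the coset of \<open>g ^ 2\<close>, so does \<open>-c\<close>.
  Multiplication by a suitable element of \<Gamma> turns the solutions of
  \<open>a + b = g ^ 2\<close> into those of \<open>a + b = -c\<close>.\<close>

lemma card_Gam_pairs_neg:
  assumes "c \<in> \<Gamma>"
  shows "card {(a, b) \<in> \<Gamma> \<times> \<Gamma>. p dvd a + b + c} = t2 p g"
proof -
  obtain j where c: "c = g ^ (4 * j) mod p" using assms by (auto simp: Gam_iff)
  obtain r where r: "k = 2 * r + 1" using odd_k by (auto elim: oddE)
  \<comment> \<open>Chosen so that \<open>g ^ 2 * u\<close> represents \<open>-c\<close>: the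
    exponent \<open>2 * k + 4 * j\<close> equals \<open>2 + 4 * (r + j)\<close>.\<close>
  define u where "u = g ^ (4 * (r + j))"
  have "2 * k + 4 * j = 2 + 4 * (r + j)" using r by simp
  then have u: "g ^ (2 * k) * g ^ (4 * j) = g ^ 2 * u"
    unfolding u_def by (metis power_add)
  have dvd_iff: "p dvd a * u mod p + b * u mod p + c \<longleftrightarrow> [a + b = g ^ 2] (mod p)" for a b
  proof -
    have "p dvd a * u mod p + b * u mod p + c \<longleftrightarrow>
        [a * u + b * u = g ^ (2 * k) * g ^ (4 * j)] (mod p)"
      unfolding dvd_sum_iff_cong_neg by (simp add: c cong_def mod_simps)
    also have "\<dots> \<longleftrightarrow> [(a + b) * u = g ^ 2 * u] (mod p)"
      by (simp only: u add_mult_distrib)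
    also have "\<dots> \<longleftrightarrow> [a + b = g ^ 2] (mod p)"
      using coprime_g by (intro cong_mult_rcancel_nat) (simp add: u_def coprime_commute)
    finally show ?thesis .
  qed
  have bij: "bij_betw (\<lambda>a. a * u mod p) \<Gamma> \<Gamma>"
    unfolding u_def by (rule bij_betw_Gam_mult)
  have "bij_betw (map_prod (\<lambda>a. a * u mod p) (\<lambda>a. a * u mod p))
      {z \<in> \<Gamma> \<times> \<Gamma>. [fst z + snd z = g ^ 2] (mod p)}
      {z \<in> \<Gamma> \<times> \<Gamma>. p dvd fst z + snd z + c}"
    by (rule bij_betw_Collect[OF bij_betw_map_prod[OF bij bij]]) (simp add: dvd_iff)
  then have "card {z \<in> \<Gamma> \<times> \<Gamma>. p dvd fst z + snd z + c} =
      card {z \<in> \<Gamma> \<times> \<Gamma>. [fst z + snd z = g ^ 2] (mod p)}"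
    by (simp add: bij_betw_same_card)
  moreover have "{(a, b) \<in> \<Gamma> \<times> \<Gamma>. P a b} = {z \<in> \<Gamma> \<times> \<Gamma>. P (fst z) (snd z)}" for P
    by auto
  ultimately show ?thesis by (simp only: t2_def)
qed

section \<open>Power moments of the periods\<close>

text \<open>The period as a function of every residue, so that orthogonality can be applied over all
  \<open>x < p\<close>; \<eta> with index \<open>s\<close> is its value at
  \<open>g ^ s\<close>.\<close>

definition period :: "nat \<Rightarrow> complex" where
  "period x = (\<Sum>a\<in>\<Gamma>. e_p p (real (x * a)))"

lemma period_cong:
  assumes "[x = y] (mod p)"
  shows "period x = period y"
  unfolding period_def
  by (intro sum.cong refl e_p_cong p_pos cong_scalar_right assms)

lemma period_0: "period 0 = of_nat k"
  by (simp add: period_def card_Gam e_p_def)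

lemma period_mult_pow_4: "period (x * g ^ (4 * i)) = period x"
proof -
  have "period x = (\<Sum>a\<in>\<Gamma>. e_p p (real (x * (a * g ^ (4 * i) mod p))))"
    unfolding period_def by (rule sum.reindex_bij_betw[OF bij_betw_Gam_mult, symmetric])
  also have "\<dots> = period (x * g ^ (4 * i))"
    unfolding period_def
    by (intro sum.cong refl e_p_cong p_pos) (simp add: cong_def mod_simps mult_ac)
  finally show ?thesis by simp
qed

lemma gauss_period_eq: "gauss_period p 4 g s = period (g ^ s)"
proof -
  have "period (g ^ s) = (\<Sum>j<k. e_p p (real (g ^ s * (g ^ (4 * j) mod p))))"
    unfolding period_def by (rule sum.reindex_bij_betw[OF bij_betw_Gam, symmetric])
  also have "\<dots> = (\<Sum>j<k. e_p p (real (g ^ (4 * j + s))))"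
    by (intro sum.cong refl e_p_cong p_pos) (simp add: cong_def mod_simps power_add mult_ac)
  also have "\<dots> = gauss_period p 4 g s"
    by (simp add: gauss_period_def p_eq)
  finally show ?thesis by simp
qed

lemma cnj_period_neg: "cnj (period x) = period (x * g ^ (2 * k))"
proof -
  have "p dvd x * g ^ (2 * k) * a + x * a" for a
    by (simp add: dvd_sum_iff_cong_neg mult_ac)
  then have "cnj (e_p p (real (x * a))) = e_p p (real (x * g ^ (2 * k) * a))" for a
    by (intro cnj_e_p p_pos) (simp add: add.commute)
  then show ?thesis by (simp add: period_def)
qed

text \<open>Conjugation replaces \<open>x\<close> by \<open>-x\<close>, and -1 differs from
  \<open>g ^ 2\<close> by a factor in \<Gamma>.\<close>

lemma cnj_period: "cnj (period x) = period (x * g ^ 2)"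
proof -
  obtain r where "k = 2 * r + 1" using odd_k by (auto elim: oddE)
  then have "x * g ^ (2 * k) = x * g ^ 2 * g ^ (4 * r)"
    by (simp add: algebra_simps power2_eq_square flip: power_add)
  then show ?thesis by (simp only: cnj_period_neg period_mult_pow_4)
qed

text \<open>The nonzero residues split into four cosets of \<Gamma> with \<open>k\<close> elements
  each, and the period is constant on each; 0 contributes \<open>F k\<close>. A general
  \<open>F\<close> covers all the moments, including the one with conjugates.\<close>

lemma sum_period_residues:
  fixes F :: "complex \<Rightarrow> complex"
  shows "(\<Sum>x<p. F (period x)) = F (of_nat k) + of_nat k * (\<Sum>s<4. F (period (g ^ s)))"
proof -
  have bij: "bij_betw (\<lambda>i. g ^ i mod p) {..<4 * k} {0<..<p}"
    using residue_primroot_is_generator[OF p_gt_1 primroot] prime_p p_eq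
    by (simp add: totient_prime totatives_prime)
  have "{..<p} = insert 0 {0<..<p}" using p_pos by auto
  then have "(\<Sum>x<p. F (period x)) = F (of_nat k) + (\<Sum>x\<in>{0<..<p}. F (period x))"
    by (simp add: period_0)
  also have "(\<Sum>x\<in>{0<..<p}. F (period x)) = (\<Sum>i<4 * k. F (period (g ^ i mod p)))"
    by (rule sum.reindex_bij_betw[OF bij, symmetric])
  also have "\<dots> = (\<Sum>i<k * 4. F (period (g ^ i)))"
    by (intro sum.cong arg_cong[where f = F] period_cong) (auto simp: mult.commute)
  \<comment> \<open>Each block of four consecutive exponents meets every coset once.\<close>
  also have "\<dots> = (\<Sum>m<k. \<Sum>i\<in>{m * 4..<m * 4 + 4}. F (period (g ^ i)))"
    by (rule sum.nat_group[symmetric])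
  also have "\<dots> = (\<Sum>m<k. \<Sum>s<4. F (period (g ^ s)))"
  proof (rule sum.cong[OF refl])
    fix m
    have "(\<Sum>i\<in>{m * 4..<m * 4 + 4}. F (period (g ^ i))) =
        (\<Sum>s<4. F (period (g ^ s * g ^ (4 * m))))"
      by (subst sum.atLeastLessThan_shift_0) (simp add: lessThan_atLeast0 power_add mult_ac)
    then show "(\<Sum>i\<in>{m * 4..<m * 4 + 4}. F (period (g ^ i))) = (\<Sum>s<4. F (period (g ^ s)))"
      by (simp only: period_mult_pow_4)
  qed
  finally show ?thesis by simp
qed

text \<open>Each further factor adds a coordinate from \<Gamma> to the index set; two applications
  produce the cube.\<close>

lemma period_mult_sum:
  assumes "finite S"
  shows "period x * (\<Sum>i\<in>S. e_p p (real (x * f i))) =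
    (\<Sum>z\<in>\<Gamma> \<times> S. e_p p (real (x * (fst z + f (snd z)))))"
  unfolding period_def sum_product sum.cartesian_product
  by (rule sum.cong[OF refl]) (auto simp: e_p_add algebra_simps)

lemma sum_gauss_period: "(\<Sum>s<4. period (g ^ s)) = -1"
proof -
  have "(\<Sum>x<p. period x) = of_nat p * of_nat (card {a \<in> \<Gamma>. p dvd a})"
    unfolding period_def by (rule sum_e_p_count[OF p_pos finite_Gam])
  also have "{a \<in> \<Gamma>. p dvd a} = {}" using not_dvd_Gam by blast
  finally have "of_nat k * ((\<Sum>s<4. period (g ^ s)) + 1) = 0"
    using sum_period_residues[of "\<lambda>z. z"] by (simp add: algebra_simps)
  then show ?thesis using k_pos by (simp add: add_eq_0_iff2)
qed

text \<open>No two elements of \<Gamma> have sum 0, so the sum over all residues vanishes: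
  \<open>0 = k ^ 2 + k * S\<close> for the sum \<open>S\<close> sought.\<close>

lemma sum_gauss_period_square: "(\<Sum>s<4. period (g ^ s) ^ 2) = - of_nat k"
proof -
  have "period x ^ 2 = (\<Sum>z\<in>\<Gamma> \<times> \<Gamma>. e_p p (real (x * (fst z + snd z))))" for x
    using period_mult_sum[of \<Gamma> x "\<lambda>a. a"] by (simp add: power2_eq_square period_def)
  then have "(\<Sum>x<p. period x ^ 2) =
      of_nat p * of_nat (card {z \<in> \<Gamma> \<times> \<Gamma>. p dvd fst z + snd z})"
    by (simp only: sum_e_p_count[OF p_pos] finite_cartesian_product finite_Gam)
  also have "{z \<in> \<Gamma> \<times> \<Gamma>. p dvd fst z + snd z} = {}"
    using no_Gam_sum_zero by auto
  finally have "of_nat k * ((\<Sum>s<4. period (g ^ s) ^ 2) + of_nat k) = 0"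
    using sum_period_residues[of "\<lambda>z. z ^ 2"] by (simp add: algebra_simps power2_eq_square)
  then show ?thesis using k_pos by (simp add: add_eq_0_iff2)
qed

text \<open>Conjugation changes the sign of the second coordinate, so only the \<open>k\<close>
  diagonal pairs count: \<open>p * k = k ^ 2 + k * S\<close> for the sum \<open>S\<close>
  sought.\<close>

lemma sum_gauss_period_norm:
  "(\<Sum>s<4. period (g ^ s) * cnj (period (g ^ s))) = of_nat p - of_nat k"
proof -
  have "period x * cnj (period x) =
      (\<Sum>z\<in>\<Gamma> \<times> \<Gamma>. e_p p (real (x * (fst z + g ^ (2 * k) * snd z))))" for x
    using period_mult_sum[of \<Gamma> x "\<lambda>a. g ^ (2 * k) * a"] cnj_period_neg[of x]
    by (simp add: period_def mult_ac)
  then have "(\<Sum>x<p. period x * cnj (period x)) =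
      of_nat p * of_nat (card {z \<in> \<Gamma> \<times> \<Gamma>. p dvd fst z + g ^ (2 * k) * snd z})"
    by (simp only: sum_e_p_count[OF p_pos] finite_cartesian_product finite_Gam)
  also have "{z \<in> \<Gamma> \<times> \<Gamma>. p dvd fst z + g ^ (2 * k) * snd z} = (\<lambda>a. (a, a)) ` \<Gamma>"
  proof -
    have "p dvd a + g ^ (2 * k) * b \<longleftrightarrow> a = b" if "a \<in> \<Gamma>" "b \<in> \<Gamma>" for a b
    proof -
      have "p dvd a + g ^ (2 * k) * b \<longleftrightarrow> [g ^ (2 * k) * b = g ^ (2 * k) * a] (mod p)"
        by (subst add.commute) (rule dvd_sum_iff_cong_neg)
      also have "\<dots> \<longleftrightarrow> [b = a] (mod p)"
        using coprime_g by (intro cong_mult_lcancel_nat) (simp add: coprime_commute)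
      also have "\<dots> \<longleftrightarrow> a = b" using that by (auto simp: cong_def Gam_less)
      finally show ?thesis .
    qed
    then show ?thesis by auto
  qed
  also have "card ((\<lambda>a. (a, a)) ` \<Gamma>) = k"
    by (subst card_image) (auto simp: inj_on_def card_Gam)
  finally have "of_nat k * ((\<Sum>s<4. period (g ^ s) * cnj (period (g ^ s))) + of_nat k) =
      of_nat k * of_nat p"
    using sum_period_residues[of "\<lambda>z. z * cnj z"] by (simp add: algebra_simps)
  then show ?thesis using k_pos by (simp add: eq_diff_eq)
qed

text \<open>The count is of triples in \<Gamma> with sum 0. Fixing one coordinate leaves
  \<open>t2 p g\<close> choices for the others, which gives
  \<open>p * k * t2 p g = k ^ 3 + k * S\<close> for the sum \<open>S\<close> sought.\<close>

lemma sum_gauss_period_cube: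
  "(\<Sum>s<4. period (g ^ s) ^ 3) = of_nat p * of_nat (t2 p g) - of_nat k ^ 2"
proof -
  have sq: "period x * period x = (\<Sum>z\<in>\<Gamma> \<times> \<Gamma>. e_p p (real (x * (fst z + snd z))))" for x
    using period_mult_sum[of \<Gamma> x "\<lambda>a. a"] by (simp add: period_def)
  have "period x ^ 3 =
      (\<Sum>z\<in>\<Gamma> \<times> \<Gamma> \<times> \<Gamma>. e_p p (real (x * (fst z + (fst (snd z) + snd (snd z))))))" for x
    using period_mult_sum[of "\<Gamma> \<times> \<Gamma>" x "\<lambda>z. fst z + snd z"]
    by (simp only: power3_eq_cube mult.assoc finite_cartesian_product finite_Gam flip: sq)
  then have "(\<Sum>x<p. period x ^ 3) = of_nat p *
      of_nat (card {z \<in> \<Gamma> \<times> \<Gamma> \<times> \<Gamma>. p dvd fst z + (fst (snd z) + snd (snd z))})"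
    by (simp only: sum_e_p_count[OF p_pos] finite_cartesian_product finite_Gam)
  also have "{z \<in> \<Gamma> \<times> \<Gamma> \<times> \<Gamma>. p dvd fst z + (fst (snd z) + snd (snd z))} =
      (SIGMA c:\<Gamma>. {(a, b) \<in> \<Gamma> \<times> \<Gamma>. p dvd a + b + c})"
    by (auto simp: add_ac)
  also have "card \<dots> = (\<Sum>c\<in>\<Gamma>. card {(a, b) \<in> \<Gamma> \<times> \<Gamma>. p dvd a + b + c})"
    by (intro card_SigmaI ballI finite_Gam) (rule finite_subset[of _ "\<Gamma> \<times> \<Gamma>"], auto)
  also have "\<dots> = (\<Sum>c\<in>\<Gamma>. t2 p g)"
    by (rule sum.cong[OF refl]) (rule card_Gam_pairs_neg)
  also have "\<dots> = k * t2 p g"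
    by (simp add: card_Gam)
  finally have "of_nat k * ((\<Sum>s<4. period (g ^ s) ^ 3) + of_nat k ^ 2) =
      of_nat k * (of_nat p * of_nat (t2 p g) :: complex)"
    using sum_period_residues[of "\<lambda>z. z ^ 3"]
    by (simp add: algebra_simps power2_eq_square power3_eq_cube)
  then show ?thesis using k_pos by (simp add: eq_diff_eq)
qed

section \<open>From the moments to the formula and the upper bound\<close>

text \<open>The four periods form two conjugate pairs. For \<open>z\<close> with
  \<open>a = 2 * Re z\<close> and \<open>A = |z|^2\<close>, the sum of \<open>z ^ 2\<close> and its
  conjugate is \<open>a ^ 2 - 2 * A\<close>, and that of \<open>z ^ 3\<close> and its conjugate is
  \<open>a ^ 3 - 3 * A * a\<close>.\<close>

lemma gauss_period_moments:
  fixes a A b B :: real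
  defines "a \<equiv> 2 * Re (period 1)" and "A \<equiv> cmod (period 1) ^ 2"
    and "b \<equiv> 2 * Re (period g)" and "B \<equiv> cmod (period g) ^ 2"
  shows "V4 p g = 2 * (A ^ 2 + B ^ 2)"
    and "a + b = -1"
    and "2 * (A + B) = real p - real k"
    and "a ^ 2 + b ^ 2 = 2 * (A + B) - real k"
    and "a ^ 3 + b ^ 3 - 3 * (A * a + B * b) = real p * real (t2 p g) - real k ^ 2"
proof -
  have per: "period (g ^ 2) = cnj (period 1)" "period (g ^ 3) = cnj (period g)"
    using cnj_period[of 1] cnj_period[of g] by (simp_all add: power3_eq_cube power2_eq_square mult_ac)
  have sum4: "(\<Sum>s<4. f s) = f 0 + f 1 + f 2 + f 3" for f :: "nat \<Rightarrow> 'x::comm_monoid_add"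
    by (simp add: eval_nat_numeral)
  note expand = sum4 per power_0 power_one_right
  show "V4 p g = 2 * (A ^ 2 + B ^ 2)"
    unfolding V4_def gauss_period_eq expand by (simp add: A_def B_def)
  note defs = a_def A_def b_def B_def cmod_power2
  show "a + b = -1"
    using arg_cong[OF sum_gauss_period[unfolded expand], of Re] by (simp add: a_def b_def)
  show "2 * (A + B) = real p - real k"
    using arg_cong[OF sum_gauss_period_norm[unfolded expand], of Re]
    unfolding defs by (simp add: power2_eq_square)
  show "a ^ 2 + b ^ 2 = 2 * (A + B) - real k"
    using arg_cong[OF sum_gauss_period_square[unfolded expand], of Re]
    unfolding defs by (simp add: power2_eq_square algebra_simps)
  show "a ^ 3 + b ^ 3 - 3 * (A * a + B * b) = real p * real (t2 p g) - real k ^ 2"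
    using arg_cong[OF sum_gauss_period_cube[unfolded expand], of Re]
    unfolding defs by (simp add: power2_eq_square power3_eq_cube algebra_simps)
qed

lemma
  shows V4_eq: "V4 p g = ((3 * real p + 1) / 8) ^ 2 +
      real p * (real p - 5 - 16 * real (t2 p g)) ^ 2 / 576"
    and V4_le: "V4 p g \<le> ((3 * real p + 1) / 8) ^ 2 + ((real p + sqrt (real p)) / 4) ^ 2"
proof -
  define a A b B where "a = 2 * Re (period 1)" and "A = cmod (period 1) ^ 2"
    and "b = 2 * Re (period g)" and "B = cmod (period g) ^ 2"
  note moments = gauss_period_moments[folded a_def A_def b_def B_def]
  define q where "q = real p"
  define t where "t = real (t2 p g)"
  define D where "D = A - B"
  define d where "d = a - b"
  have k: "real k = (q - 1) / 4" using p_eq by (simp add: q_def)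
  have sum_AB: "A + B = (3 * q + 1) / 8" using moments(3) k by (simp add: q_def field_simps)
  \<comment> \<open>Both sums \<open>A + B\<close> and \<open>a + b\<close> are known, so the
    differences \<open>D\<close> and \<open>d\<close> are the only unknowns left.\<close>
  have A_eq: "A = ((3 * q + 1) / 8 + D) / 2" and B_eq: "B = ((3 * q + 1) / 8 - D) / 2"
    using sum_AB by (simp_all add: D_def field_simps)
  have a_eq: "a = (d - 1) / 2" and b_eq: "b = (- d - 1) / 2"
    using moments(2) by (auto simp: d_def)
  have d_sq: "d ^ 2 = q"
    using moments(4) k unfolding A_eq B_eq a_eq b_eq
    by (simp add: power2_eq_square field_simps)
  have q: "q > 0" using p_pos by (simp add: q_def)
  have "a ^ 3 + b ^ 3 = - (3 * d ^ 2 + 1) / 4" "A * a + B * b = (D * d - (3 * q + 1) / 8) / 2"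
    unfolding A_eq B_eq a_eq b_eq
    by (simp_all add: power2_eq_square power3_eq_cube field_simps)
  then have Dd: "D * d = q * (q - 5 - 16 * t) / 24"
    using moments(5) k d_sq unfolding q_def[symmetric] t_def[symmetric]
    by (simp add: power2_eq_square field_simps)
  \<comment> \<open>The sign of \<open>d\<close> is unknown, so the relation is squared and
    \<open>d ^ 2 = q\<close> is inserted.\<close>
  have "D ^ 2 * q = (q * (q - 5 - 16 * t) ^ 2 / 576) * q"
    using arg_cong[OF Dd, of "\<lambda>x. x ^ 2"] d_sq
    by (simp add: power_mult_distrib power_divide power2_eq_square[of q] mult_ac)
  then have D_sq: "D ^ 2 = q * (q - 5 - 16 * t) ^ 2 / 576" using q by simp
  have V4: "V4 p g = ((3 * q + 1) / 8) ^ 2 + D ^ 2"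
    using moments(1) unfolding A_eq B_eq by (simp add: power2_eq_square field_simps)
  show "V4 p g = ((3 * real p + 1) / 8) ^ 2 + real p * (real p - 5 - 16 * real (t2 p g)) ^ 2 / 576"
    unfolding V4 D_sq by (simp add: q_def t_def)
  have "abs d = sqrt q" using d_sq by (metis real_sqrt_abs)
  then have d_le: "d \<le> sqrt q" "- d \<le> sqrt q" by auto
  \<comment> \<open>The real part is at most the modulus. In terms of \<open>D\<close> and
    \<open>d\<close> these read \<open>- D \<le> (q + d) / 4\<close> and
    \<open>D \<le> (q - d) / 4\<close>.\<close>
  have "a ^ 2 \<le> 4 * A" "b ^ 2 \<le> 4 * B"
    by (simp_all add: a_def A_def b_def B_def cmod_power2 power_mult_distrib)
  then have "- D \<le> (q + sqrt q) / 4" "D \<le> (q + sqrt q) / 4"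
    using d_le d_sq unfolding A_eq B_eq a_eq b_eq
    by (simp_all add: power2_eq_square field_simps)
  then have "D ^ 2 \<le> ((q + sqrt q) / 4) ^ 2"
    by (intro power2_le_iff_abs_le[THEN iffD2]) auto
  then show "V4 p g \<le> ((3 * real p + 1) / 8) ^ 2 + ((real p + sqrt (real p)) / 4) ^ 2"
    unfolding V4 by (simp add: q_def)
qed

section \<open>Points on the curve\<close>

text \<open>The affine part \<open>z = 1\<close> of the curve.\<close>

definition quartic_solutions :: "(nat \<times> nat) set" where
  "quartic_solutions = {(x, y) \<in> {0..<p} \<times> {0..<p}. [x ^ 4 + y ^ 4 = g ^ 2] (mod p)}"

text \<open>In exponents, \<open>4 * n = 4 * j\<close> modulo \<open>4 * k\<close> means
  \<open>n = j\<close> modulo \<open>k\<close>, which has four solutions modulo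
  \<open>4 * k\<close>.\<close>

lemma card_fourth_roots:
  assumes "a \<in> \<Gamma>"
  shows "card {x \<in> {0..<p}. x ^ 4 mod p = a} = 4"
proof -
  obtain j where a: "a = g ^ (4 * j) mod p" using assms by (auto simp: Gam_iff)
  have root_iff: "(g ^ n mod p) ^ 4 mod p = a \<longleftrightarrow> n mod k = j mod k" for n
  proof -
    have "(g ^ n mod p) ^ 4 mod p = a \<longleftrightarrow> [g ^ (4 * n) = g ^ (4 * j)] (mod p)"
      by (simp add: a cong_def power_mod mult.commute flip: power_mult)
    also have "\<dots> \<longleftrightarrow> n mod k = j mod k"
      unfolding pow_g_cong_iff by (simp add: cong_def)
    finally show ?thesis .
  qed
  let ?f = "\<lambda>m. g ^ (j mod k + k * m) mod p"
  have "inj_on ?f {..<4}"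
  proof (rule inj_onI)
    fix m n assume mn: "m \<in> {..<4::nat}" "n \<in> {..<4}" "?f m = ?f n"
    then have "[j mod k + k * m = j mod k + k * n] (mod 4 * k)"
      unfolding pow_g_cong_iff[symmetric] by (simp add: cong_def)
    then have "[k * m = k * n] (mod k * 4)"
      by (simp only: cong_add_lcancel_nat mult.commute[of 4])
    then show "m = n" using k_pos mn by (simp add: cong_def)
  qed
  moreover have "{x \<in> {0..<p}. x ^ 4 mod p = a} = ?f ` {..<4}"
  proof (intro equalityI subsetI)
    fix x assume "x \<in> {x \<in> {0..<p}. x ^ 4 mod p = a}"
    then have x: "x < p" "x ^ 4 mod p = a" by auto
    have "\<not> p dvd x"
    proof
      assume "p dvd x"
      then have "p dvd x ^ 4" by (simp add: prime_dvd_power_iff prime_p)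
      then show False using x(2) not_dvd_Gam[OF assms] by auto
    qed
    then obtain n where n: "n < 4 * k" "[x = g ^ n] (mod p)" by (rule not_dvd_imp_pow_g)
    then have x_eq: "x = g ^ n mod p" using x(1) by (simp add: cong_def)
    then have "n mod k = j mod k" using x(2) root_iff by simp
    then have "j mod k + k * (n div k) = n" by (metis mod_mult_div_eq)
    moreover have "n div k < 4" using n(1) k_pos by (simp add: less_mult_imp_div_less)
    ultimately show "x \<in> ?f ` {..<4}" using x_eq by (intro image_eqI[of _ _ "n div k"]) auto
  next
    fix x assume "x \<in> ?f ` {..<4}"
    then obtain m where x_eq: "x = ?f m" by (rule imageE)
    have "x ^ 4 mod p = a" unfolding x_eq root_iff by simp
    then show "x \<in> {x \<in> {0..<p}. x ^ 4 mod p = a}" using x_eq p_pos by simp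
  qed
  ultimately show ?thesis by (simp add: card_image)
qed

text \<open>Exponents of fourth powers are multiples of 4, and 2 is not one modulo
  \<open>4 * k\<close>. This rules out affine points with a zero coordinate.\<close>

lemma fourth_power_neq_g_square: "\<not> [x ^ 4 = g ^ 2] (mod p)"
proof
  assume x: "[x ^ 4 = g ^ 2] (mod p)"
  have "\<not> p dvd x"
  proof
    assume "p dvd x"
    then have "[x ^ 4 = 0] (mod p)" by (simp add: cong_0_iff prime_dvd_power_iff prime_p)
    then show False using x not_dvd_pow_g[of 2] by (metis cong_0_iff cong_sym cong_trans)
  qed
  then obtain n where "[x = g ^ n] (mod p)" by (rule not_dvd_imp_pow_g)
  then have "[x ^ 4 = g ^ (4 * n)] (mod p)"
    using cong_pow[of x "g ^ n" p 4] by (simp add: mult.commute flip: power_mult)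
  then have "[g ^ (4 * n) = g ^ 2] (mod p)" using x by (metis cong_sym cong_trans)
  then have "[4 * n = 2] (mod 4 * k)" by (simp only: pow_g_cong_iff)
  then have "[4 * n = 2] (mod 4)" by (rule cong_dvd_modulus_nat) simp
  then show False by (simp add: cong_def)
qed

text \<open>The map taking \<open>(x, y)\<close> to the pair of fourth powers has the pairs counted
  by \<open>t2\<close> as image, with fibres of size \<open>4 * 4\<close>.\<close>

lemma card_quartic_solutions: "card quartic_solutions = 16 * t2 p g"
proof -
  let ?Q = "{(a, b) \<in> \<Gamma> \<times> \<Gamma>. [a + b = g ^ 2] (mod p)}"
  define R where "R a = {x \<in> {0..<p}. x ^ 4 mod p = a}" for a
  have not_dvd: "\<not> p dvd x" if "[x ^ 4 + y ^ 4 = g ^ 2] (mod p)" for x y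
  proof
    assume "p dvd x"
    then have "[x ^ 4 = 0] (mod p)" by (simp add: cong_0_iff prime_dvd_power_iff prime_p)
    then have "[x ^ 4 + y ^ 4 = 0 + y ^ 4] (mod p)" by (rule cong_add) simp
    then show False
      using that fourth_power_neq_g_square[of y] by (metis add_0 cong_sym cong_trans)
  qed
  have "quartic_solutions = (\<Union>z\<in>?Q. R (fst z) \<times> R (snd z))"
  proof (intro equalityI subsetI)
    fix w assume "w \<in> quartic_solutions"
    then obtain x y where w: "w = (x, y)" "x < p" "y < p"
      and eq: "[x ^ 4 + y ^ 4 = g ^ 2] (mod p)"
      by (auto simp: quartic_solutions_def)
    have "x ^ 4 mod p \<in> \<Gamma>" using not_dvd[OF eq] by (rule pow_4_in_Gam)
    moreover have "y ^ 4 mod p \<in> \<Gamma>"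
      by (rule pow_4_in_Gam, rule not_dvd[of y x]) (use eq in \<open>simp add: add.commute\<close>)
    moreover have "[x ^ 4 mod p + y ^ 4 mod p = g ^ 2] (mod p)"
      using eq by (simp add: cong_def mod_simps)
    ultimately show "w \<in> (\<Union>z\<in>?Q. R (fst z) \<times> R (snd z))"
      using w by (intro UN_I[of "(x ^ 4 mod p, y ^ 4 mod p)"]) (auto simp: R_def)
  next
    fix w assume "w \<in> (\<Union>z\<in>?Q. R (fst z) \<times> R (snd z))"
    then obtain x y where w: "w = (x, y)" "x < p" "y < p"
      and "[x ^ 4 mod p + y ^ 4 mod p = g ^ 2] (mod p)"
      by (auto simp: R_def)
    then have "[x ^ 4 + y ^ 4 = g ^ 2] (mod p)"
      by (simp add: cong_def mod_simps)
    then show "w \<in> quartic_solutions" using w by (simp add: quartic_solutions_def)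
  qed
  moreover have "card (\<Union>z\<in>?Q. R (fst z) \<times> R (snd z)) = (\<Sum>z\<in>?Q. card (R (fst z) \<times> R (snd z)))"
  proof (rule card_UN_disjoint)
    show "finite ?Q" by (rule finite_subset[of _ "\<Gamma> \<times> \<Gamma>"]) auto
  qed (auto simp: R_def)
  moreover have "card (R (fst z) \<times> R (snd z)) = 16" if "z \<in> ?Q" for z
    using that card_fourth_roots by (auto simp: R_def card_cartesian_product)
  ultimately show ?thesis by (simp add: t2_def)
qed

text \<open>Every point of the curve has a unique representative with \<open>z = 1\<close>, because
  there are no points at infinity.\<close>

lemma card_curve_points: "card (curve_points p g) = card quartic_solutions"
proof -
  note equiv = equiv_proportional[OF prime_p]
  let ?f = "\<lambda>(x, y). proportional p `` {(x, y, 1)}"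
  have triple: "(x, y, 1) \<in> nonzero_triples p" if "x < p" "y < p" for x y
    using that p_gt_1 by (simp add: nonzero_triples_def)
  have inj: "inj_on ?f quartic_solutions"
  proof (rule inj_onI, clarify)
    fix x y x' y'
    assume xy: "(x, y) \<in> quartic_solutions" "(x', y') \<in> quartic_solutions"
      and "proportional p `` {(x, y, 1)} = proportional p `` {(x', y', 1)}"
    then have lt: "x < p" "y < p" "x' < p" "y' < p"
      by (auto simp: quartic_solutions_def)
    have "((x, y, 1), (x', y', 1)) \<in> proportional p"
      by (rule eq_equiv_class[OF _ equiv triple]) fact+
    then obtain c where "c < p" "[x' = c * x] (mod p)" "[y' = c * y] (mod p)" "[1 = c * 1] (mod p)"
      by (auto simp: proportional_def)
    moreover from this have "c = 1" using p_gt_1 by (simp add: cong_def)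
    ultimately show "x = x' \<and> y = y'"
      using lt by (simp add: cong_def)
  qed
  have "?f ` quartic_solutions = curve_points p g"
  proof (intro equalityI subsetI)
    fix P assume "P \<in> ?f ` quartic_solutions"
    then obtain x y where xy: "x < p" "y < p" "[x ^ 4 + y ^ 4 = g ^ 2] (mod p)"
      and P: "P = proportional p `` {(x, y, 1)}"
      by (auto simp: quartic_solutions_def)
    have "P \<in> proj_plane p"
      unfolding P proj_plane_def by (rule quotientI) (rule triple[OF xy(1,2)])
    moreover have "[x' ^ 4 + y' ^ 4 = g ^ 2 * z' ^ 4] (mod p)" if "(x', y', z') \<in> P" for x' y' z'
    proof -
      obtain c where c: "[x' = c * x] (mod p)" "[y' = c * y] (mod p)" "[z' = c * 1] (mod p)"
        using \<open>(x', y', z') \<in> P\<close> by (auto simp: P proportional_def)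
      have "[x ^ 4 + y ^ 4 = g ^ 2 * 1 ^ 4] (mod p)" using xy(3) by simp
      then show ?thesis using c by (rule fourth_powers_cong_scale)
    qed
    ultimately show "P \<in> curve_points p g" by (auto simp: curve_points_def)
  next
    fix P assume P_in: "P \<in> curve_points p g"
    then obtain x y z where xyz: "(x, y, z) \<in> nonzero_triples p"
      and P: "P = proportional p `` {(x, y, z)}"
      by (auto simp: curve_points_def proj_plane_def elim!: quotientE)
    then have "(x, y, z) \<in> P" using equiv_class_self[OF equiv] by simp
    then have curve: "[x ^ 4 + y ^ 4 = g ^ 2 * z ^ 4] (mod p)"
      using P_in by (auto simp: curve_points_def)
    have lt: "x < p" "y < p" "z < p" using xyz by (auto simp: nonzero_triples_def)
    \<comment> \<open>At infinity \<open>x ^ 4 + y ^ 4 = 0\<close>. If one coordinate vanishes, all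
      do; otherwise two elements of \<Gamma> have sum 0.\<close>
    have "\<not> p dvd z"
    proof
      assume "p dvd z"
      then have "p dvd g ^ 2 * z ^ 4" by (simp add: prime_dvd_power_iff prime_p)
      then have dvd: "p dvd x ^ 4 + y ^ 4" using curve cong_dvd_iff by blast
      show False
      proof (cases "p dvd x \<or> p dvd y")
        case True
        moreover have "p dvd x ^ 4 \<longleftrightarrow> p dvd y ^ 4"
          using dvd by (metis dvd_add_right_iff dvd_add_left_iff)
        ultimately have "p dvd x" "p dvd y"
          by (simp_all add: prime_dvd_power_iff prime_p)
        then have "x = 0" "y = 0" "z = 0"
          using \<open>p dvd z\<close> lt by (auto dest: nat_dvd_not_less)
        then show False using xyz by (simp add: nonzero_triples_def)
      next
        case False
        then have "\<not> p dvd x ^ 4 mod p + y ^ 4 mod p"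
          by (intro no_Gam_sum_zero pow_4_in_Gam) auto
        then show False using dvd by (simp only: dvd_eq_mod_eq_0 mod_add_eq)
      qed
    qed
    then obtain c where c: "c \<in> {1..<p}" "[c * z = 1] (mod p)"
      by (rule unit_inverse_mod_prime[OF prime_p])
    let ?x = "c * x mod p" and ?y = "c * y mod p"
    have "((x, y, z), (?x, ?y, 1)) \<in> proportional p"
      using xyz c triple[of ?x ?y] p_pos by (auto simp: proportional_def cong_def)
    then have "P = ?f (?x, ?y)"
      unfolding P using equiv_class_eq[OF equiv] by simp
    moreover have "[?x ^ 4 + ?y ^ 4 = g ^ 2 * 1 ^ 4] (mod p)"
      by (rule fourth_powers_cong_scale[OF curve _ _ cong_sym[OF c(2)]]) (simp_all add: cong_def)
    then have "(?x, ?y) \<in> quartic_solutions"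
      using p_pos by (simp add: quartic_solutions_def)
    ultimately show "P \<in> ?f ` quartic_solutions" by (rule image_eqI)
  qed
  then show ?thesis using card_image[OF inj] by simp
qed

end

theorem theorem3p3:
  fixes p g :: nat
  assumes "prime p" and "[p = 5] (mod 8)" and "residue_primroot p g"
  shows "16 * t2 p g = card (curve_points p g) \<and>
    V4 p g = 1 / 576 * (real p ^ 3 + 71 * real p ^ 2 + 256 * real p * real (t2 p g) ^ 2
           - 32 * (real p - 5) * real p * real (t2 p g) + 79 * real p + 9) \<and>
    1 / 64 * (9 * real p ^ 2 + 6 * real p + 1) \<le> V4 p g \<and>
    V4 p g \<le> 1 / 64 * (13 * real p ^ 2 + 8 * real p powr (3 / 2) + 10 * real p + 1)"
proof -
  define k where "k = (p - 1) div 4"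
  have "p mod 8 = 5" using assms(2) by (simp add: cong_def)
  then have "p = 4 * k + 1" "odd k"
    unfolding k_def by presburger+
  then interpret quartic_periods p g k
    using assms by unfold_locales
  have "real p powr (3 / 2) = real p powr (1 + 1 / 2)" by simp
  also have "\<dots> = real p * sqrt (real p)"
    using p_pos by (simp only: powr_add) (simp add: powr_half_sqrt)
  finally have powr_eq: "real p powr (3 / 2) = real p * sqrt (real p)" .
  have "16 * t2 p g = card (curve_points p g)"
    by (simp add: card_curve_points card_quartic_solutions)
  moreover have "V4 p g = 1 / 576 * (real p ^ 3 + 71 * real p ^ 2 + 256 * real p * real (t2 p g) ^ 2
      - 32 * (real p - 5) * real p * real (t2 p g) + 79 * real p + 9)"
    unfolding V4_eq by (simp add: power2_eq_square power3_eq_cube field_simps)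
  \<comment> \<open>The term with \<open>t2\<close> is a nonnegative multiple of a square and is
    dropped.\<close>
  moreover have "((3 * real p + 1) / 8) ^ 2 \<le> V4 p g"
    unfolding V4_eq by simp
  then have "1 / 64 * (9 * real p ^ 2 + 6 * real p + 1) \<le> V4 p g"
    by (simp add: power2_eq_square field_simps)
  moreover have "((3 * real p + 1) / 8) ^ 2 + ((real p + sqrt (real p)) / 4) ^ 2 =
      1 / 64 * (13 * real p ^ 2 + 8 * real p powr (3 / 2) + 10 * real p + 1)"
    unfolding powr_eq by (simp add: power2_eq_square field_simps)
  then have "V4 p g \<le> 1 / 64 * (13 * real p ^ 2 + 8 * real p powr (3 / 2) + 10 * real p + 1)"
    using V4_le by simp
  ultimately show ?thesis by blast
qed

end
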